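(* Let $K$ be a field of characteristic zero and let $v=\sum_{j=0}^{m}a_j\lambda^j\in K[\lambda]$ have $a_m\neq0$ and $a_0\neq0$. Let $\varepsilon$ be the number of distinct roots of $v$ in an algebraic closure of $K$. If $$a_r=a_{r+1}=\dots=a_{r+g-1}=0\qquad\text{for some } r\ge1 \text{ with } r+g-1\le m-1,$$ then $g\le\varepsilon-1$. Equivalently, a gap of $g$ consecutive vanishing coefficients strictly between the two extreme ones forces at least $g+1$ distinct roots. The bound is attained by $v=\lambda^m-\gamma$, $\gamma\neq0$ (for which $\varepsilon=m$ and $g=m-1$).
   Context: Here $r$ and $g$ are integers with $g\ge0$ (for $g=0$ the vanishing condition is empty). *)

theory Defs
  imports
    "HOL-Computational_Algebra.Polynomial"
    "HOL-Algebra.Algebraic_Closure_Type"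
begin

text \<open>Roots are counted without multiplicity. For the zero polynomial the set below is the
  whole closure, which is infinite in characteristic zero, so the value is then the junk value 0.\<close>

definition num_distinct_roots :: "'k::field_char_0 poly \<Rightarrow> nat" where
  "num_distinct_roots v = card {z :: 'k alg_closure. poly (map_poly to_ac v) z = 0}"

text \<open>The coefficients \<open>a r, \<dots>, a (r + g - 1)\<close> vanish, and these indices lie strictly between
  0 and m. Indices are integers so that \<open>m - 1\<close> does not truncate; for \<open>g = 0\<close> the
  interval is empty but \<open>1 \<le> r\<close> and \<open>r \<le> m\<close> are still required.\<close>

definition coeff_gap :: "(nat \<Rightarrow> 'k::field_char_0) \<Rightarrow> nat \<Rightarrow> int \<Rightarrow> int \<Rightarrow> bool" where
  "coeff_gap a m r g \<longleftrightarrow>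
     0 \<le> g \<and> 1 \<le> r \<and> r + g - 1 \<le> int m - 1 \<and> (\<forall>j\<in>{r..r + g - 1}. a (nat j) = 0)"

end

theory Submission
  imports Defs
begin

text \<open>Let \<open>h\<close> be the product of \<open>\<lambda> - z\<close> over the distinct roots \<open>z\<close> of \<open>v\<close>, so that
  \<open>deg h = \<epsilon>\<close> and \<open>h v' = v w\<close> with \<open>deg w = \<epsilon> - 1\<close>. A gap of length \<open>g\<close> splits \<open>v\<close> as
  \<open>P + R\<close> with \<open>deg P < r\<close> and \<open>\<lambda>\<^sup>r\<^sup>+\<^sup>g\<close> dividing \<open>R\<close>, both nonzero. If \<open>g \<ge> \<epsilon>\<close>, the
  contributions of \<open>P\<close> and \<open>R\<close> to \<open>h v' - v w = 0\<close> have no power of \<open>\<lambda>\<close> in common, hence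
  \<open>h P' = P w\<close> as well. Thus \<open>P' v = P v'\<close>, and comparing leading coefficients yields
  \<open>deg P = deg v\<close>, a contradiction. The bound applied to \<open>\<lambda>\<^sup>m - \<gamma>\<close> itself shows that this
  polynomial has \<open>m\<close> distinct roots.\<close>

text \<open>By induction with the product rule: the derivative of \<open>[:-a, 1:] * f\<close> times
  \<open>h\<close> is \<open>h * f\<close>, divisible because \<open>h\<close> contains the factor
  \<open>[:-a, 1:]\<close>, plus \<open>[:-a, 1:] * (h * pderiv f)\<close>, covered by the induction
  hypothesis.\<close>

lemma prod_linear_dvd_radical_mult_pderiv:
  fixes A :: "'a::idom multiset"
  assumes "finite S" "set_mset A \<subseteq> S"
  shows "(\<Prod>x\<in>#A. [:-x, 1:]) dvd (\<Prod>x\<in>S. [:-x, 1:]) * pderiv (\<Prod>x\<in>#A. [:-x, 1:])"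
  using assms(2)
proof (induction A)
  case empty
  then show ?case by simp
next
  case (add a A)
  let ?f = "\<Prod>x\<in>#A. [:-x, 1:]" and ?h = "\<Prod>x\<in>S. [:-x, 1:]"
  have "[:-a, 1:] dvd ?h"
    using add.prems assms(1) by (intro dvd_prodI) auto
  then have "[:-a, 1:] * ?f dvd ?h * ?f"
    by (rule mult_dvd_mono) simp
  moreover have "[:-a, 1:] * ?f dvd [:-a, 1:] * (?h * pderiv ?f)"
    using add by (intro mult_dvd_mono) auto
  moreover have "?h * pderiv ([:-a, 1:] * ?f) = ?h * ?f + [:-a, 1:] * (?h * pderiv ?f)"
    by (simp only: pderiv_mult) (simp add: pderiv_pCons algebra_simps)
  ultimately have "[:-a, 1:] * ?f dvd ?h * pderiv ([:-a, 1:] * ?f)"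
    by (metis dvd_add)
  then show ?case by simp
qed

lemma radical_mult_pderiv:
  fixes p :: "'a::alg_closed_field poly"
  assumes "p \<noteq> 0"
  obtains h w where "h \<noteq> 0" "degree h = card {x. poly p x = 0}" "h * pderiv p = p * w"
proof -
  obtain A where A: "p = smult (lead_coeff p) (\<Prod>x\<in>#A. [:-x, 1:])"
    using alg_closed_imp_factorization[OF assms] by blast
  let ?f = "\<Prod>x\<in>#A. [:-x, 1:]" and ?S = "{x. poly p x = 0}"
  define h where "h = (\<Prod>x\<in>?S. [:-x, 1:])"
  have "set_mset A \<subseteq> ?S"
  proof
    fix x assume "x \<in># A"
    then have "[:-x, 1:] dvd ?f"
      by (metis dvd_prod_mset image_eqI set_image_mset)
    then have "[:-x, 1:] dvd p"
      by (subst A) (rule dvd_smult)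
    then show "x \<in> ?S" by (simp add: poly_eq_0_iff_dvd)
  qed
  then have "?f dvd h * pderiv ?f"
    unfolding h_def using poly_roots_finite[OF assms]
    by (intro prod_linear_dvd_radical_mult_pderiv)
  then obtain w where w: "h * pderiv ?f = ?f * w" ..
  have "h * pderiv (smult (lead_coeff p) ?f) = smult (lead_coeff p) ?f * w"
    using w by (simp add: pderiv_smult)
  then have "h * pderiv p = p * w"
    unfolding A[symmetric] .
  moreover have "h \<noteq> 0"
    unfolding h_def using poly_roots_finite[OF assms] by simp
  moreover have "degree h = card ?S"
    unfolding h_def by (subst degree_prod_eq_sum_degree) auto
  ultimately show ?thesis using that by blast
qed

lemma lead_coeff_pderiv:
  fixes p :: "'a::{idom, semiring_char_0} poly"
  shows "lead_coeff (pderiv p) = of_nat (degree p) * lead_coeff p"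
  by (cases "degree p") (auto simp: degree_pderiv coeff_pderiv coeff_eq_0)

lemma coeff_gap_less_card_roots:
  fixes p :: "'a::{alg_closed_field, field_char_0} poly"
  assumes "poly.coeff p 0 \<noteq> 0" "1 \<le> r" "r + g \<le> degree p"
    and gap: "\<And>j. r \<le> j \<Longrightarrow> j < r + g \<Longrightarrow> poly.coeff p j = 0"
  shows "g < card {x. poly p x = 0}"
proof (rule ccontr)
  let ?e = "card {x. poly p x = 0}"
  assume "\<not> g < ?e"
  then have e: "?e \<le> g" by simp
  have p0: "p \<noteq> 0" and deg: "degree p \<ge> 1" using assms by auto
  from p0 obtain h w where h: "h \<noteq> 0" "degree h = ?e" and hw: "h * pderiv p = p * w"
    by (rule radical_mult_pderiv)
  have p': "pderiv p \<noteq> 0" using deg by (simp add: pderiv_eq_0_iff)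
  have "w \<noteq> 0" using hw h p' by auto
  \<comment> \<open>Characteristic zero makes the degree of \<open>p\<close> drop by exactly one
    under \<open>pderiv\<close>.\<close>
  then have "degree p + degree w = ?e + (degree p - 1)"
    using arg_cong[OF hw, of degree] h p0 p' by (simp add: degree_mult_eq degree_pderiv)
  then have w: "degree w + 1 = ?e" using deg by linarith

  \<comment> \<open>Multiplying the derivation by \<open>\<lambda>\<close> lets it neither raise degrees nor lower orders at 0.\<close>
  define \<theta> where "\<theta> q = pCons 0 (pderiv q)" for q :: "'a poly"
  define u where "u = pCons 0 w"
  define P where "P = poly_cutoff r p"
  define R where "R = p - P"
  define D where "D = h * \<theta> P - P * u"
  have coeff_\<theta>: "poly.coeff (\<theta> q) k = of_nat k * poly.coeff q k" for q k
    by (cases k) (auto simp: \<theta>_def coeff_pderiv)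
  have \<theta>_add: "\<theta> (q1 + q2) = \<theta> q1 + \<theta> q2" for q1 q2
    by (simp add: \<theta>_def pderiv_add)
  \<comment> \<open>The map \<open>q\<close> to \<open>h * \<theta> q - q * u\<close> is additive
    and kills \<open>P + R\<close>, so its values at \<open>P\<close> and \<open>R\<close> are
    opposite. \<open>D\<close> is thus bounded in degree through \<open>P\<close> and in order at 0
    through \<open>R\<close>.\<close>
  have "h * \<theta> p = p * u" using hw by (simp add: \<theta>_def u_def)
  moreover have "p = P + R" by (simp add: R_def)
  ultimately have D_eq: "D = R * u - h * \<theta> R"
    by (simp add: D_def \<theta>_add algebra_simps)

  have degP: "degree P \<le> r - 1"
    using \<open>1 \<le> r\<close> by (intro degree_le) (auto simp: P_def coeff_poly_cutoff)
  have deg_\<theta>: "degree (\<theta> P) \<le> r - 1"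
    using degP by (intro degree_le) (auto simp: coeff_\<theta> coeff_eq_0)
  have "degree u \<le> ?e" using w by (simp add: u_def)
  then have "degree D \<le> ?e + (r - 1)"
    unfolding D_def using degP deg_\<theta> h(2) degree_mult_le[of h "\<theta> P"] degree_mult_le[of P u]
    by (intro degree_diff_le) linarith+
  moreover have "Polynomial.monom 1 (r + g) dvd D"
  proof -
    have "poly.coeff R k = 0" if "k < r + g" for k
      using that gap[of k] by (auto simp: R_def P_def coeff_poly_cutoff)
    then have "Polynomial.monom 1 (r + g) dvd R" "Polynomial.monom 1 (r + g) dvd \<theta> R"
      by (auto simp: monom_1_dvd_iff' coeff_\<theta>)
    then show ?thesis unfolding D_eq by (intro dvd_diff dvd_mult dvd_mult2)
  qed
  \<comment> \<open>A nonzero multiple of the monomial has degree at least \<open>r + g\<close>, but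
    \<open>?e + (r - 1) < r + g\<close> since \<open>?e \<le> g\<close>.\<close>
  ultimately have "D = 0"
    using e \<open>1 \<le> r\<close> dvd_imp_degree_le[of "Polynomial.monom 1 (r + g)" D]
    by (cases "D = 0") (auto simp: degree_monom_eq)
  then have hP: "h * pderiv P = P * w" by (simp add: D_def \<theta>_def u_def)
  \<comment> \<open>Both \<open>P\<close> and \<open>p\<close> have logarithmic derivative
    \<open>w / h\<close>; cross-multiplying and cancelling \<open>h\<close> eliminates
    \<open>w\<close>.\<close>
  have "h * (pderiv P * p) = (h * pderiv P) * p" by (simp only: mult.assoc)
  also have "\<dots> = P * (p * w)" by (simp only: hP mult.assoc mult.commute[of w])
  also have "\<dots> = h * (P * pderiv p)" by (simp only: hw[symmetric] mult.left_commute)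
  finally have "pderiv P * p = P * pderiv p" using h by simp
  then have "lead_coeff (pderiv P) * lead_coeff p = lead_coeff P * lead_coeff (pderiv p)"
    by (metis lead_coeff_mult)
  moreover have "poly.coeff P 0 \<noteq> 0"
    using assms by (simp add: P_def coeff_poly_cutoff)
  then have "P \<noteq> 0" by auto
  ultimately have "degree P = degree p"
    using p0 by (simp add: lead_coeff_pderiv)
  then show False using degP assms by linarith
qed

text \<open>The embedding \<open>to_ac\<close> preserves the degree and maps nonzero coefficients to
  nonzero ones and zero to zero, so the bound over the closure applies.\<close>

lemma coeff_gap_le_num_distinct_roots:
  fixes v :: "'k::field_char_0 poly"
  assumes v: "v = (\<Sum>j=0..m. Polynomial.monom (a j) j)" and "a m \<noteq> 0" "a 0 \<noteq> 0"
    and gap: "coeff_gap a m r g"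
  shows "g + 1 \<le> int (num_distinct_roots v)"
proof -
  have coeff_v: "poly.coeff v j = (if j \<le> m then a j else 0)" for j
    by (auto simp: v coeff_sum)
  have "degree v = m"
    using \<open>a m \<noteq> 0\<close> by (intro antisym degree_le le_degree) (auto simp: coeff_v)
  let ?V = "map_poly to_ac v"
  have "nat g < card {z. poly ?V z = 0}"
  proof (rule coeff_gap_less_card_roots[where r = "nat r"])
    show "poly.coeff ?V 0 \<noteq> 0" using \<open>a 0 \<noteq> 0\<close> by (simp add: coeff_map_poly coeff_v)
    show "1 \<le> nat r" "nat r + nat g \<le> degree ?V"
      using gap \<open>degree v = m\<close> by (auto simp: coeff_gap_def degree_map_poly)
    show "poly.coeff ?V j = 0" if "nat r \<le> j" "j < nat r + nat g" for j
    proof -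
      have "int j \<in> {r..r + g - 1}" using that gap by (auto simp: coeff_gap_def)
      then have "a (nat (int j)) = 0" using gap unfolding coeff_gap_def by blast
      then show ?thesis by (simp add: coeff_map_poly coeff_v)
    qed
  qed
  then show ?thesis unfolding num_distinct_roots_def by linarith
qed

lemma num_distinct_roots_le_degree:
  assumes "v \<noteq> 0"
  shows "num_distinct_roots v \<le> degree v"
  using card_poly_roots_bound[of "map_poly to_ac v"] assms
  by (simp add: num_distinct_roots_def degree_map_poly map_poly_eq_0_iff)

lemma num_distinct_roots_monom_minus_const:
  fixes \<gamma> :: "'k::field_char_0"
  assumes "m \<ge> 1" "\<gamma> \<noteq> 0" and v: "v = Polynomial.monom 1 m - [:\<gamma>:]"
  shows "v = (\<Sum>j=0..m. Polynomial.monom (poly.coeff v j) j)" (is ?expansion)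
    and "poly.coeff v m \<noteq> 0" "poly.coeff v 0 \<noteq> 0"
    and "coeff_gap (poly.coeff v) m 1 (int m - 1)"
    and "num_distinct_roots v = m"
proof -
  have coeff_v: "poly.coeff v j = (if j = 0 then - \<gamma> else if j = m then 1 else 0)" for j
    using \<open>m \<ge> 1\<close> by (cases j) (auto simp: v)
  have deg: "degree v \<le> m" by (intro degree_le) (auto simp: coeff_v)
  then show exp: ?expansion
    by (metis atLeast0AtMost poly_as_sum_of_monoms')
  show lead: "poly.coeff v m \<noteq> 0" and const: "poly.coeff v 0 \<noteq> 0"
    using assms(1,2) by (auto simp: coeff_v)
  show gap: "coeff_gap (poly.coeff v) m 1 (int m - 1)"
    using \<open>m \<ge> 1\<close> by (auto simp: coeff_gap_def coeff_v)
  have "v \<noteq> 0" using const by auto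
  \<comment> \<open>The gap of length \<open>m - 1\<close>, empty for \<open>m = 1\<close>, gives at
    least \<open>m\<close> roots; the degree allows at most \<open>m\<close>.\<close>
  from coeff_gap_le_num_distinct_roots[OF exp lead const gap]
    num_distinct_roots_le_degree[OF \<open>v \<noteq> 0\<close>] deg
  show "num_distinct_roots v = m" by linarith
qed

theorem lemma5p6:
  shows "(\<forall>(v :: 'k::field_char_0 poly) (a :: nat \<Rightarrow> 'k) (m :: nat) (r :: int) (g :: int).
            v = (\<Sum>j=0..m. Polynomial.monom (a j) j) \<and> a m \<noteq> 0 \<and> a 0 \<noteq> 0 \<and> coeff_gap a m r g \<longrightarrow>
              g \<le> int (num_distinct_roots v) - 1 \<and> g + 1 \<le> int (num_distinct_roots v))
       \<and> (\<forall>(m :: nat) (\<gamma> :: 'k) (v :: 'k poly).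
            m \<ge> 1 \<and> \<gamma> \<noteq> 0 \<and> v = Polynomial.monom 1 m - [:\<gamma>:] \<longrightarrow>
              v = (\<Sum>j=0..m. Polynomial.monom (poly.coeff v j) j) \<and>
              poly.coeff v m \<noteq> 0 \<and> poly.coeff v 0 \<noteq> 0 \<and>
              coeff_gap (poly.coeff v) m 1 (int m - 1) \<and>
              num_distinct_roots v = m \<and>
              int m - 1 = int (num_distinct_roots v) - 1)"
proof (rule conjI; intro allI impI; elim conjE)
  fix v :: "'k poly" and a m r g
  assume "v = (\<Sum>j=0..m. Polynomial.monom (a j) j)" "a m \<noteq> 0" "a 0 \<noteq> 0" "coeff_gap a m r g"
  from coeff_gap_le_num_distinct_roots[OF this]
  show "g \<le> int (num_distinct_roots v) - 1 \<and> g + 1 \<le> int (num_distinct_roots v)"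
    by linarith
next
  fix m and \<gamma> :: 'k and v
  assume "m \<ge> 1" "\<gamma> \<noteq> 0" "v = Polynomial.monom 1 m - [:\<gamma>:]"
  note * = num_distinct_roots_monom_minus_const[OF this]
  show "v = (\<Sum>j=0..m. Polynomial.monom (poly.coeff v j) j) \<and>
      poly.coeff v m \<noteq> 0 \<and> poly.coeff v 0 \<noteq> 0 \<and>
      coeff_gap (poly.coeff v) m 1 (int m - 1) \<and>
      num_distinct_roots v = m \<and>
      int m - 1 = int (num_distinct_roots v) - 1"
    using *(2-5) by (intro conjI *(1)) simp_all
qed

end
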